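(* Let $X$ be a complex Banach space and let $A\subseteq B(X)$ be an abelian, unital, strongly closed subalgebra with spectral synthesis. If $A$ has split strict multiplicity $s.s.m.(A)=p\in\mathbb{N}$, then $A$ is hereditarily reflexive.
   Context: $B(X)$ is the algebra of bounded linear operators on $X$; "strongly closed" means closed in the strong operator topology; $A$ carries the operator norm. An algebra $A\subset B(X)$ has split strict multiplicity $p\in\mathbb{N}$, written $s.s.m.(A)=p$, if there are $x_1,\dots,x_p\in X$ such that the subspaces $X_i=\{ax_i : a\in A\}$ are closed and $X=X_1\oplus\cdots\oplus X_p$. $A$ (as an abelian unital Banach algebra) has spectral synthesis if every norm closed ideal of $A$ is the intersection of the maximal ideals of $A$ containing it. A linear subspace $\mathcal{L}\subseteq B(X)$ is reflexive if every $T\in B(X)$ satisfying $Tx\in\overline{\mathcal{L}x}$ for every $x\in X$ belongs to $\mathcal{L}$. The algebra $A$ is hereditarily reflexive if every strongly closed subspace $\mathcal{L}\subseteq A$ is reflexive. *)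

theory Defs
  imports "HOL-Analysis.Analysis"
begin

class complex_normed_vector = real_normed_vector +
  fixes scaleC :: "complex \<Rightarrow> 'a \<Rightarrow> 'a" (infixr "*\<^sub>C" 75)
  assumes scaleC_add_right: "c *\<^sub>C (x + y) = c *\<^sub>C x + c *\<^sub>C y"
    and scaleC_add_left: "(c + d) *\<^sub>C x = c *\<^sub>C x + d *\<^sub>C x"
    and scaleC_scaleC: "c *\<^sub>C d *\<^sub>C x = (c * d) *\<^sub>C x"
    and scaleR_scaleC: "r *\<^sub>R x = complex_of_real r *\<^sub>C x"
    and norm_scaleC: "norm (c *\<^sub>C x) = cmod c * norm x"

class complex_banach = complex_normed_vector + banach

instantiation complex :: complex_normed_vector
begin

definition scaleC_complex :: "complex \<Rightarrow> complex \<Rightarrow> complex"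
  where "scaleC_complex c z = c * z"

instance
  by standard (auto simp: scaleC_complex_def algebra_simps norm_mult scaleR_conv_of_real)

end

instance complex :: complex_banach ..

lemma scaleC_one: "1 *\<^sub>C x = (x :: 'a::complex_normed_vector)"
  using scaleR_scaleC[of 1 x] by simp

lemma bounded_linear_scaleC: "bounded_linear (\<lambda>x :: 'a::complex_normed_vector. c *\<^sub>C x)"
proof (rule bounded_linear_intro)
  show "c *\<^sub>C (x + y) = c *\<^sub>C x + c *\<^sub>C y" for x y :: 'a
    by (rule scaleC_add_right)
  show "c *\<^sub>C r *\<^sub>R x = r *\<^sub>R c *\<^sub>C x" for r and x :: 'a
    by (simp add: scaleR_scaleC scaleC_scaleC mult.commute)
  show "norm (c *\<^sub>C x) \<le> norm x * cmod c" for x :: 'a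
    by (simp add: norm_scaleC)
qed

instantiation blinfun :: (real_normed_vector, complex_normed_vector) complex_normed_vector
begin

lift_definition scaleC_blinfun :: "complex \<Rightarrow> ('a \<Rightarrow>\<^sub>L 'b) \<Rightarrow> ('a \<Rightarrow>\<^sub>L 'b)"
  is "\<lambda>c f x. c *\<^sub>C f x"
  by (rule bounded_linear_compose[OF bounded_linear_scaleC])

instance
proof
  fix c d :: complex and r :: real and S T :: "'a \<Rightarrow>\<^sub>L 'b"
  show "c *\<^sub>C (S + T) = c *\<^sub>C S + c *\<^sub>C T"
    by transfer (auto simp: scaleC_add_right)
  show "(c + d) *\<^sub>C S = c *\<^sub>C S + d *\<^sub>C S"
    by transfer (auto simp: scaleC_add_left)
  show "c *\<^sub>C d *\<^sub>C S = (c * d) *\<^sub>C S"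
    by transfer (auto simp: scaleC_scaleC)
  show "r *\<^sub>R S = complex_of_real r *\<^sub>C S"
    by transfer (auto simp: scaleR_scaleC)
  have le: "norm (e *\<^sub>C U) \<le> cmod e * norm U" for e and U :: "'a \<Rightarrow>\<^sub>L 'b"
  proof (rule norm_blinfun_bound)
    fix x
    show "norm (blinfun_apply (e *\<^sub>C U) x) \<le> cmod e * norm U * norm x"
      using mult_left_mono[OF norm_blinfun[of U x], of "cmod e"]
      by (simp add: scaleC_blinfun.rep_eq norm_scaleC mult.assoc)
  qed simp
  show "norm (c *\<^sub>C S) = cmod c * norm S"
  proof (cases "c = 0")
    case True
    then show ?thesis using le[of c S] by simp
  next
    case False
    have "inverse c *\<^sub>C c *\<^sub>C S = 1 *\<^sub>C S"
      using False by transfer (simp add: scaleC_scaleC)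
    also have "\<dots> = S"
      by transfer (simp add: scaleC_one)
    finally have "norm S \<le> cmod (inverse c) * norm (c *\<^sub>C S)"
      using le[of "inverse c" "c *\<^sub>C S"] by simp
    then have "cmod c * norm S \<le> norm (c *\<^sub>C S)"
      using False by (simp add: norm_divide field_simps)
    with le[of c S] show ?thesis by simp
  qed
qed

end

definition csubspace :: "'a::complex_normed_vector set \<Rightarrow> bool"
  where "csubspace = module.subspace scaleC"

lemma csubspace_iff:
  "csubspace S \<longleftrightarrow> 0 \<in> S \<and> (\<forall>x\<in>S. \<forall>y\<in>S. x + y \<in> S) \<and> (\<forall>c. \<forall>x\<in>S. c *\<^sub>C x \<in> S)"
proof -
  interpret module "scaleC :: complex \<Rightarrow> 'a \<Rightarrow> 'a"
    by standard (simp_all add: scaleC_add_right scaleC_add_left scaleC_scaleC scaleC_one)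
  show ?thesis by (auto simp: csubspace_def subspace_def)
qed

text \<open>
  The type \<open>'a \<Rightarrow>\<^sub>L 'a\<close> consists of the bounded real-linear maps, so $B(X)$ is the set of
  complex-linear ones among them. The operator norm is the same over both fields.
\<close>

definition complex_operators :: "('a::complex_normed_vector \<Rightarrow>\<^sub>L 'a) set"  (\<open>\<B>\<close>)
  where "\<B> = {T. \<forall>c x. blinfun_apply T (c *\<^sub>C x) = c *\<^sub>C blinfun_apply T x}"

definition strongly_closed :: "('a::complex_normed_vector \<Rightarrow>\<^sub>L 'a) set \<Rightarrow> bool"
  where "strongly_closed S \<longleftrightarrow> closedin (subtopology strong_operator_topology \<B>) S"

definition operator_subalgebra :: "('a::complex_normed_vector \<Rightarrow>\<^sub>L 'a) set \<Rightarrow> bool"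
  where "operator_subalgebra A \<longleftrightarrow> A \<subseteq> \<B> \<and> csubspace A \<and> (\<forall>S\<in>A. \<forall>T\<in>A. S o\<^sub>L T \<in> A)"

definition unital :: "('a::complex_normed_vector \<Rightarrow>\<^sub>L 'a) set \<Rightarrow> bool"
  where "unital A \<longleftrightarrow> id_blinfun \<in> A"

definition abelian :: "('a::complex_normed_vector \<Rightarrow>\<^sub>L 'a) set \<Rightarrow> bool"
  where "abelian A \<longleftrightarrow> (\<forall>S\<in>A. \<forall>T\<in>A. S o\<^sub>L T = T o\<^sub>L S)"

definition algebra_ideal ::
    "('a::complex_normed_vector \<Rightarrow>\<^sub>L 'a) set \<Rightarrow> ('a \<Rightarrow>\<^sub>L 'a) set \<Rightarrow> bool"
  where "algebra_ideal A J \<longleftrightarrow>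
    J \<subseteq> A \<and> csubspace J \<and> (\<forall>S\<in>A. \<forall>T\<in>J. S o\<^sub>L T \<in> J \<and> T o\<^sub>L S \<in> J)"

definition maximal_algebra_ideal ::
    "('a::complex_normed_vector \<Rightarrow>\<^sub>L 'a) set \<Rightarrow> ('a \<Rightarrow>\<^sub>L 'a) set \<Rightarrow> bool"
  where "maximal_algebra_ideal A M \<longleftrightarrow>
    algebra_ideal A M \<and> M \<noteq> A \<and>
    (\<forall>J. algebra_ideal A J \<and> M \<subseteq> J \<longrightarrow> J = M \<or> J = A)"

text \<open>
  Intersections are taken within \<open>A\<close>: the empty one, which arises for \<open>J = A\<close>, is \<open>A\<close>.
\<close>

definition spectral_synthesis :: "('a::complex_normed_vector \<Rightarrow>\<^sub>L 'a) set \<Rightarrow> bool"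
  where "spectral_synthesis A \<longleftrightarrow>
    (\<forall>J. algebra_ideal A J \<and> closedin (top_of_set A) J \<longrightarrow>
      J = A \<inter> \<Inter>{M. maximal_algebra_ideal A M \<and> J \<subseteq> M})"

definition orbit :: "('a::complex_normed_vector \<Rightarrow>\<^sub>L 'a) set \<Rightarrow> 'a \<Rightarrow> 'a set"
  where "orbit L x = (\<lambda>T. blinfun_apply T x) ` L"

definition is_direct_sum :: "('i \<Rightarrow> 'a::complex_normed_vector set) \<Rightarrow> 'i set \<Rightarrow> bool"
  where "is_direct_sum Y I \<longleftrightarrow>
    (\<forall>i\<in>I. csubspace (Y i)) \<and> (\<forall>x. \<exists>!y. y \<in> (\<Pi>\<^sub>E i\<in>I. Y i) \<and> x = (\<Sum>i\<in>I. y i))"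

definition split_strict_multiplicity ::
    "('a::complex_normed_vector \<Rightarrow>\<^sub>L 'a) set \<Rightarrow> nat \<Rightarrow> bool"
  where "split_strict_multiplicity A p \<longleftrightarrow>
    (\<exists>x :: nat \<Rightarrow> 'a. (\<forall>i\<in>{1..p}. closed (orbit A (x i))) \<and>
      is_direct_sum (\<lambda>i. orbit A (x i)) {1..p})"

definition reflexive :: "('a::complex_normed_vector \<Rightarrow>\<^sub>L 'a) set \<Rightarrow> bool"
  where "reflexive L \<longleftrightarrow>
    (\<forall>T\<in>\<B>. (\<forall>x. blinfun_apply T x \<in> closure (orbit L x)) \<longrightarrow> T \<in> L)"

definition hereditarily_reflexive :: "('a::complex_normed_vector \<Rightarrow>\<^sub>L 'a) set \<Rightarrow> bool"
  where "hereditarily_reflexive A \<longleftrightarrow>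
    (\<forall>L. L \<subseteq> A \<and> csubspace L \<and> strongly_closed L \<longrightarrow> reflexive L)"

end

theory Submission
  imports Defs
begin

text \<open>
  Let \<open>J\<^sub>i\<close> be the annihilator of \<open>x\<^sub>i\<close>, so that \<open>X\<^sub>i = A x\<^sub>i\<close> is isomorphic to \<open>A / J\<^sub>i\<close> by the open
  mapping theorem. Let \<open>T x\<close> lie in the closure of \<open>L x\<close> for every \<open>x\<close>. For a maximal ideal \<open>M\<close>
  containing \<open>J\<^sub>i\<close>, the operator \<open>T\<close> maps \<open>M x\<^sub>i\<close> into itself, and \<open>A = \<complex> + M\<close> by the Gelfand-Mazur
  theorem; hence \<open>T b x\<^sub>i = b T x\<^sub>i\<close> modulo \<open>M x\<^sub>i\<close> for \<open>b \<in> A\<close>. Spectral synthesis says that \<open>J\<^sub>i\<close>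
  is the intersection of these \<open>M\<close>, so \<open>T\<close> commutes with \<open>b\<close> on \<open>X\<^sub>i\<close>.
  Now take \<open>l \<in> L\<close> such that \<open>l v\<close> is close to \<open>T v\<close> for \<open>v = x\<^sub>1 + \<dots> + x\<^sub>p\<close>. Then \<open>l x\<^sub>i\<close>
  is close to \<open>T x\<^sub>i\<close> for each \<open>i\<close>, and since every vector is a sum of \<open>a\<^sub>i x\<^sub>i\<close> with \<open>a\<^sub>i \<in> A\<close> of
  controlled norm, \<open>l\<close> is close to \<open>T\<close> in norm. So \<open>T\<close> is in the closed subspace \<open>L\<close>.
\<close>

section \<open>Open mapping theorem for a finite family of operators\<close>

text \<open>Baire category puts a ball into the closure of the image of some ball. Scaling then
  approximates every \<open>y\<close> up to half its norm with controlled coefficients; repeating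
  this on the error and summing a geometric series makes the representation exact. The coefficients
  range over a closed subspace \<open>S\<close> because the algebra in question is a set, not a
  type.\<close>

lemma open_mapping_family:
  fixes f :: "'i \<Rightarrow> 'b::banach \<Rightarrow> 'a::banach"
  assumes fin: "finite I" and f: "\<And>i. i \<in> I \<Longrightarrow> bounded_linear (f i)"
    and S: "subspace S" "closed S"
    and surj: "\<And>y. \<exists>a. (\<forall>i\<in>I. a i \<in> S) \<and> y = (\<Sum>i\<in>I. f i (a i))"
  obtains C where "C \<ge> 0"
    "\<And>y. \<exists>a. (\<forall>i\<in>I. a i \<in> S \<and> norm (a i) \<le> C * norm y) \<and> y = (\<Sum>i\<in>I. f i (a i))"
proof -
  \<comment> \<open>\<open>B t\<close> is the image of the ball of radius \<open>t\<close> in the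
    power of \<open>S\<close> indexed by \<open>I\<close>, with the maximum norm.\<close>
  define B where "B t = {y. \<exists>a. (\<forall>i\<in>I. a i \<in> S \<and> norm (a i) \<le> t) \<and> y = (\<Sum>i\<in>I. f i (a i))}"
    for t :: real
  have B_scaleR: "c *\<^sub>R y \<in> B (\<bar>c\<bar> * t)" if y: "y \<in> B t" for c t y
  proof -
    obtain a where a: "\<forall>i\<in>I. a i \<in> S \<and> norm (a i) \<le> t" "y = (\<Sum>i\<in>I. f i (a i))"
      using y unfolding B_def by blast
    have "c *\<^sub>R y = (\<Sum>i\<in>I. f i (c *\<^sub>R a i))"
      using f by (simp add: a(2) scaleR_sum_right linear_simps)
    then show ?thesis
      unfolding B_def using a(1) S(1)
      by (intro CollectI exI[of _ "\<lambda>i. c *\<^sub>R a i"]) (auto intro: subspace_scale mult_left_mono)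
  qed
  have B_diff: "y - z \<in> B (s + t)" if y: "y \<in> B s" and z: "z \<in> B t" for s t y z
  proof -
    obtain a where a: "\<forall>i\<in>I. a i \<in> S \<and> norm (a i) \<le> s" "y = (\<Sum>i\<in>I. f i (a i))"
      using y unfolding B_def by blast
    obtain b where b: "\<forall>i\<in>I. b i \<in> S \<and> norm (b i) \<le> t" "z = (\<Sum>i\<in>I. f i (b i))"
      using z unfolding B_def by blast
    have "y - z = (\<Sum>i\<in>I. f i (a i - b i))"
      using f by (simp add: a(2) b(2) sum_subtractf linear_simps)
    moreover have "norm (a i - b i) \<le> s + t" if "i \<in> I" for i
      using bspec[OF a(1) that] bspec[OF b(1) that] norm_triangle_ineq4[of "a i" "b i"] by linarith
    ultimately show ?thesis
      unfolding B_def using a(1) b(1) S(1)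
      by (intro CollectI exI[of _ "\<lambda>i. a i - b i"]) (auto intro: subspace_diff)
  qed
  have "\<exists>n::nat. y \<in> B (real n)" for y
  proof -
    obtain a where a: "\<forall>i\<in>I. a i \<in> S" "y = (\<Sum>i\<in>I. f i (a i))"
      using surj by blast
    obtain n :: nat where n: "(\<Sum>i\<in>I. norm (a i)) \<le> real n"
      using real_arch_simple by blast
    have "norm (a i) \<le> real n" if "i \<in> I" for i
      using member_le_sum[OF that, of "\<lambda>i. norm (a i)"] fin n by simp
    then show ?thesis using a by (auto simp: B_def)
  qed
  then have UN: "(\<Union>n::nat. closure (B (real n))) = UNIV"
    using closure_subset by blast
  have "\<exists>n::nat. interior (closure (B (real n))) \<noteq> {}"
  proof (rule ccontr)
    assume "\<not> ?thesis"
    then have "Met_TC.mtopology interior_of \<Union>(range (\<lambda>n. closure (B (real n)))) = {}"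
      by (intro Met_TC.metric_Baire_category_alt) (auto simp: complete_UNIV)
    then show False using UN by simp
  qed
  then obtain n :: nat and w e where "e > 0" and ball: "ball w e \<subseteq> closure (B (real n))"
    by (meson all_not_in_conv mem_interior)
  \<comment> \<open>A difference of two elements of \<open>B (real n)\<close> has coefficients up to
    \<open>2 * real n\<close>, and the division by \<open>t\<close> below multiplies them by
    \<open>2 * norm y / e\<close>; \<open>K\<close> collects both factors.\<close>
  define K where "K = 4 * real n / e"
  have "K \<ge> 0" using \<open>e > 0\<close> by (simp add: K_def)
  have approx: "\<exists>z\<in>B (K * norm y). norm (y - z) \<le> norm y / 2" for y
  proof (cases "y = 0")
    case True
    have "0 \<in> B 0"
      using f S(1) by (auto simp: B_def linear_simps subspace_0 intro!: exI[of _ "\<lambda>_. 0"])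
    then show ?thesis using True by auto
  next
    case False
    \<comment> \<open>The vector \<open>t *\<^sub>R y\<close> has norm \<open>e / 2\<close>, so
      \<open>w\<close> and \<open>w + t *\<^sub>R y\<close> both lie in the ball. Approximating each
      within \<open>e / 8\<close> costs at most \<open>e / 4\<close>, which becomes
      \<open>norm y / 2\<close> after division by \<open>t\<close>.\<close>
    define t where "t = e / 2 / norm y"
    have "t > 0" using \<open>e > 0\<close> False by (simp add: t_def)
    have "norm (t *\<^sub>R y) < e" using False \<open>e > 0\<close> by (simp add: t_def)
    then have "w + t *\<^sub>R y \<in> closure (B (real n))" "w \<in> closure (B (real n))"
      using ball \<open>e > 0\<close> by (auto simp: dist_norm subset_iff)
    then obtain u v where uv: "u \<in> B (real n)" "dist u (w + t *\<^sub>R y) < e / 8"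
        "v \<in> B (real n)" "dist v w < e / 8"
      using \<open>e > 0\<close> by (meson closure_approachable divide_pos_pos zero_less_numeral)
    define z where "z = inverse t *\<^sub>R (u - v)"
    have "norm (t *\<^sub>R y - (u - v)) = norm ((v - w) - (u - (w + t *\<^sub>R y)))"
      by (simp add: algebra_simps)
    also have "\<dots> \<le> e / 4"
      using uv norm_triangle_ineq4[of "v - w" "u - (w + t *\<^sub>R y)"] by (simp add: dist_norm)
    finally have "norm (inverse t *\<^sub>R (t *\<^sub>R y - (u - v))) \<le> inverse t * (e / 4)"
      using \<open>t > 0\<close> by (simp add: mult_left_mono)
    moreover have "inverse t *\<^sub>R (t *\<^sub>R y - (u - v)) = y - z"
      using \<open>t > 0\<close> by (simp add: z_def algebra_simps)
    moreover have "inverse t * (e / 4) = norm y / 2"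
      using False \<open>e > 0\<close> by (simp add: t_def field_simps)
    ultimately have "norm (y - z) \<le> norm y / 2" by (simp only:)
    moreover have "z \<in> B (\<bar>inverse t\<bar> * (real n + real n))"
      unfolding z_def by (intro B_scaleR B_diff uv)
    moreover have "\<bar>inverse t\<bar> * (real n + real n) = K * norm y"
      using False \<open>e > 0\<close> by (simp add: t_def K_def field_simps)
    ultimately show ?thesis by auto
  qed
  have "\<exists>g. (\<forall>i\<in>I. g i \<in> S \<and> norm (g i) \<le> K * norm y) \<and>
      norm (y - (\<Sum>i\<in>I. f i (g i))) \<le> norm y / 2" for y
    using approx[of y] by (auto simp: B_def)
  then obtain g where g: "\<And>y i. i \<in> I \<Longrightarrow> g y i \<in> S \<and> norm (g y i) \<le> K * norm y"
      "\<And>y. norm (y - (\<Sum>i\<in>I. f i (g y i))) \<le> norm y / 2"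
    by metis
  show thesis
  proof (rule that[of "2 * K"])
    fix y
    \<comment> \<open>\<open>r k\<close> is what remains of \<open>y\<close> after \<open>k\<close>
      successive corrections by \<open>g\<close>; each correction at least halves the norm.\<close>
    define r where "r k = ((\<lambda>u. u - (\<Sum>i\<in>I. f i (g u i))) ^^ k) y" for k
    have r_Suc: "r (Suc k) = r k - (\<Sum>i\<in>I. f i (g (r k) i))" for k
      by (simp add: r_def)
    have r: "norm (r k) \<le> norm y * (1/2) ^ k" for k
    proof (induction k)
      case (Suc k)
      then show ?case using g(2)[of "r k"] by (simp add: r_Suc)
    qed (simp add: r_def)
    have bound: "norm (g (r k) i) \<le> K * norm y * (1/2) ^ k" if "i \<in> I" for i k
      using g(1)[OF that, of "r k"] mult_left_mono[OF r \<open>K \<ge> 0\<close>, of k] by (simp add: mult.assoc)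
    have geom: "(\<lambda>k. K * norm y * (1/2) ^ k) sums (2 * K * norm y)"
      using sums_mult[OF geometric_sums[of "1/2::real"], of "K * norm y"] by (simp add: mult_ac)
    define a where "a i = (\<Sum>k. g (r k) i)" for i
    have sum_norm: "summable (\<lambda>k. norm (g (r k) i))" if "i \<in> I" for i
      by (rule summable_comparison_test'[OF sums_summable[OF geom], of 0]) (simp add: bound that)
    have a_sums: "(\<lambda>k. g (r k) i) sums a i" if "i \<in> I" for i
      unfolding a_def using summable_norm_cancel[OF sum_norm[OF that]] by (rule summable_sums)
    have "norm (a i) \<le> 2 * K * norm y" if "i \<in> I" for i
    proof -
      have "norm (a i) \<le> (\<Sum>k. norm (g (r k) i))"
        unfolding a_def by (rule summable_norm[OF sum_norm[OF that]])
      also have "\<dots> \<le> 2 * K * norm y"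
        using suminf_le[OF bound sum_norm[OF that] sums_summable[OF geom]] that sums_unique[OF geom]
        by simp
      finally show ?thesis .
    qed
    moreover have "a i \<in> S" if "i \<in> I" for i
      by (rule closed_sequentially[OF S(2) _ a_sums[OF that, unfolded sums_def]])
        (auto intro!: subspace_sum S(1) simp: g(1) that)
    moreover have "(\<lambda>k. \<Sum>i\<in>I. f i (g (r k) i)) sums (\<Sum>i\<in>I. f i (a i))"
      by (intro sums_sum bounded_linear.sums[OF f] a_sums)
    \<comment> \<open>The corrections are the differences of consecutive remainders, so their series
      telescopes from \<open>y\<close> to 0.\<close>
    moreover have "(\<lambda>k. \<Sum>i\<in>I. f i (g (r k) i)) sums y"
    proof -
      have "(\<lambda>k. norm y * (1/2::real) ^ k) \<longlonglongrightarrow> 0"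
        by (intro tendsto_mult_right_zero LIMSEQ_power_zero) simp
      then have "r \<longlonglongrightarrow> 0"
        by (rule Lim_null_comparison[rotated]) (simp add: r)
      then have "(\<lambda>k. r k - r (Suc k)) sums (r 0 - 0)"
        by (rule telescope_sums')
      moreover have "r k - r (Suc k) = (\<Sum>i\<in>I. f i (g (r k) i))" for k
        by (simp add: r_Suc)
      ultimately show ?thesis by (simp add: r_def)
    qed
    ultimately show "\<exists>a. (\<forall>i\<in>I. a i \<in> S \<and> norm (a i) \<le> 2 * K * norm y) \<and> y = (\<Sum>i\<in>I. f i (a i))"
      using sums_unique2 by blast
  qed (use \<open>K \<ge> 0\<close> in simp)
qed

section \<open>Vanishing from an approximate four-point submean inequality\<close>

text \<open>
  The error term is of order \<open>r\<^sup>4\<close>, so adding \<open>\<epsilon> |w - z|\<^sup>2\<close> to \<open>\<phi>\<close> makes the four-point inequality strict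
  for small \<open>r\<close>, which excludes an interior maximum.
\<close>
lemma submean_vanishing_eq_0:
  fixes \<phi> :: "complex \<Rightarrow> real"
  assumes nonneg: "\<And>z. \<phi> z \<ge> 0" and cont: "continuous_on UNIV \<phi>"
    and lim: "(\<phi> \<longlongrightarrow> 0) at_infinity"
    and submean: "\<And>z r. r > 0 \<Longrightarrow> 4 * \<phi> z \<le> (1 + r ^ 4 * \<phi> z ^ 4) *
      (\<phi> (z + of_real r) + \<phi> (z - of_real r) + \<phi> (z + \<i> * of_real r) + \<phi> (z - \<i> * of_real r))"
  shows "\<phi> z = 0"
proof (rule ccontr)
  assume "\<phi> z \<noteq> 0"
  then have pos: "\<phi> z > 0" using nonneg[of z] by simp
  have "eventually (\<lambda>w. \<phi> w < \<phi> z / 4) at_infinity"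
    using order_tendstoD(2)[OF lim, of "\<phi> z / 4"] pos by simp
  then obtain b where b: "\<And>w. norm w \<ge> b \<Longrightarrow> \<phi> w < \<phi> z / 4"
    by (auto simp: eventually_at_infinity)
  \<comment> \<open>At distance \<open>\<rho>\<close> or more from \<open>z\<close> the norm is at
    least \<open>b\<close>, so the bound on \<open>\<phi>\<close> near infinity applies.\<close>
  define \<rho> where "\<rho> = \<bar>b\<bar> + norm z + 1"
  have "\<rho> > 0" by (simp add: \<rho>_def add_nonneg_pos)
  have far: "\<phi> w < \<phi> z / 4" if "norm (w - z) \<ge> \<rho>" for w
    using b[of w] norm_triangle_ineq4[of w z] that by (simp add: \<rho>_def)
  \<comment> \<open>The added term equals \<open>\<phi> z / 4\<close> on the circle of radius
    \<open>\<rho>\<close>. There \<open>g\<close> stays below \<open>\<phi> z / 2\<close>, hence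
    below \<open>g z = \<phi> z\<close>, and the maximum over the disc is interior.\<close>
  define \<epsilon> where "\<epsilon> = \<phi> z / (4 * \<rho>\<^sup>2)"
  have "\<epsilon> > 0" using pos \<open>\<rho> > 0\<close> by (simp add: \<epsilon>_def)
  have eps: "\<epsilon> * \<rho>\<^sup>2 = \<phi> z / 4" using \<open>\<rho> > 0\<close> by (simp add: \<epsilon>_def)
  define g where "g w = \<phi> w + \<epsilon> * (norm (w - z))\<^sup>2" for w
  have "continuous_on (cball z \<rho>) g"
    unfolding g_def by (intro continuous_intros continuous_on_subset[OF cont]) auto
  then obtain u where u: "u \<in> cball z \<rho>" and u_max: "\<And>w. w \<in> cball z \<rho> \<Longrightarrow> g w \<le> g u"
    using continuous_attains_sup[OF compact_cball, of z \<rho> g] \<open>\<rho> > 0\<close> by auto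
  have "norm (u - z) < \<rho>"
  proof (rule ccontr)
    assume "\<not> norm (u - z) < \<rho>"
    then have eq: "norm (u - z) = \<rho>" using u by (simp add: dist_norm norm_minus_commute)
    have "\<phi> z = g z" by (simp add: g_def)
    also have "\<dots> \<le> g u" using u_max \<open>\<rho> > 0\<close> by simp
    also have "\<dots> < \<phi> z / 4 + \<phi> z / 4" using far[of u] eq eps by (simp add: g_def)
    finally show False using pos by simp
  qed
  define \<delta> where "\<delta> = \<rho> - norm (u - z)"
  have "\<delta> > 0" using \<open>norm (u - z) < \<rho>\<close> by (simp add: \<delta>_def)
  \<comment> \<open>Summing \<open>g\<close> over the four neighbours of the maximum
    \<open>u\<close>, the squares contribute an excess \<open>4 * \<epsilon> * r\<^sup>2\<close>,
    which the error of order \<open>r ^ 4\<close> must absorb. Dividing by \<open>r\<^sup>2\<close>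
    gives the bound, and \<open>r\<close> tending to 0 then contradicts
    \<open>\<epsilon> > 0\<close>.\<close>
  have *: "\<epsilon> \<le> r\<^sup>2 * \<phi> u ^ 5" if r: "0 < r" "r < \<delta>" for r
  proof -
    define \<Sigma> where "\<Sigma> = \<phi> (u + of_real r) + \<phi> (u - of_real r) + \<phi> (u + \<i> * of_real r) + \<phi> (u - \<i> * of_real r)"
    have "g (u + c) \<le> g u" if "norm c = r" for c
      using u_max[of "u + c"] norm_triangle_ineq[of "u - z" c] that r(2)
      by (simp add: \<delta>_def dist_norm norm_minus_commute algebra_simps)
    from this[of "of_real r"] this[of "- of_real r"] this[of "\<i> * of_real r"] this[of "- (\<i> * of_real r)"]
    have "g (u + of_real r) + g (u - of_real r) + g (u + \<i> * of_real r) + g (u - \<i> * of_real r) \<le> 4 * g u"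
      using r(1) by (simp add: norm_mult)
    also have "g (u + of_real r) + g (u - of_real r) + g (u + \<i> * of_real r) + g (u - \<i> * of_real r)
      = \<Sigma> + 4 * (\<epsilon> * (norm (u - z))\<^sup>2) + 4 * (\<epsilon> * r\<^sup>2)"
      unfolding g_def \<Sigma>_def cmod_power2 by (simp add: power2_eq_square algebra_simps)
    finally have S: "\<Sigma> + 4 * (\<epsilon> * r\<^sup>2) \<le> 4 * \<phi> u" by (simp add: g_def)
    then have "\<Sigma> \<le> 4 * \<phi> u" using \<open>\<epsilon> > 0\<close> by (smt (verit) mult_nonneg_nonneg zero_le_power2)
    then have "r ^ 4 * \<phi> u ^ 4 * \<Sigma> \<le> r ^ 4 * \<phi> u ^ 4 * (4 * \<phi> u)"
      using nonneg by (intro mult_left_mono) auto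
    moreover have "4 * \<phi> u \<le> \<Sigma> + r ^ 4 * \<phi> u ^ 4 * \<Sigma>"
      using submean[OF r(1), of u] by (simp add: \<Sigma>_def algebra_simps)
    ultimately have "\<epsilon> * r\<^sup>2 \<le> r ^ 4 * \<phi> u ^ 4 * \<phi> u" using S by linarith
    also have "\<dots> = (r\<^sup>2 * \<phi> u ^ 5) * r\<^sup>2" by (simp add: eval_nat_numeral)
    finally show ?thesis using r(1) by (simp only: mult_le_cancel_right_pos zero_less_power)
  qed
  have "((\<lambda>r. r\<^sup>2 * \<phi> u ^ 5) \<longlongrightarrow> 0\<^sup>2 * \<phi> u ^ 5) (at_right 0)"
    by (intro tendsto_intros)
  moreover have "eventually (\<lambda>r. \<epsilon> \<le> r\<^sup>2 * \<phi> u ^ 5) (at_right 0)"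
    unfolding eventually_at_right_field using * \<open>\<delta> > 0\<close> by auto
  ultimately have "\<epsilon> \<le> 0"
    by (simp add: tendsto_lowerbound)
  with \<open>\<epsilon> > 0\<close> show False by simp
qed

section \<open>Distance to a subspace as a quotient seminorm\<close>

lemma infdist_approx:
  assumes "V \<noteq> {}" "e > 0"
  obtains v where "v \<in> V" "dist x v < infdist x V + e"
proof -
  have "(INF v\<in>V. dist x v) < infdist x V + e"
    using assms by (simp add: infdist_notempty)
  then show thesis
    using that assms(1) by (auto simp: cINF_less_iff bdd_belowI[of _ 0])
qed

text \<open>This is the triangle inequality of the quotient seminorm: near-best approximants of the
  two vectors add up inside \<open>V\<close>.\<close>

lemma infdist_subspace_add:
  fixes V :: "'a::real_normed_vector set"
  assumes "subspace V"
  shows "infdist (x + y) V \<le> infdist x V + infdist y V"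
proof (rule field_le_epsilon)
  fix e :: real assume "e > 0"
  have "V \<noteq> {}" using subspace_0[OF assms] by auto
  obtain v where v: "v \<in> V" "dist x v < infdist x V + e / 2"
    using infdist_approx[OF \<open>V \<noteq> {}\<close>, of "e / 2" x] \<open>e > 0\<close> by auto
  obtain w where w: "w \<in> V" "dist y w < infdist y V + e / 2"
    using infdist_approx[OF \<open>V \<noteq> {}\<close>, of "e / 2" y] \<open>e > 0\<close> by auto
  have "infdist (x + y) V \<le> dist (x + y) (v + w)"
    by (intro infdist_le subspace_add assms v w)
  also have "\<dots> \<le> dist x v + dist y w" by (rule dist_triangle_add)
  finally show "infdist (x + y) V \<le> infdist x V + infdist y V + e" using v w by simp
qed

lemma infdist_subspace_cong:
  fixes V :: "'a::real_normed_vector set"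
  assumes "subspace V" "x - y \<in> V"
  shows "infdist x V = infdist y V"
proof (rule antisym)
  show "infdist x V \<le> infdist y V"
    using infdist_subspace_add[OF assms(1), of "x - y" y] assms(2) by simp
  have "y - x \<in> V" using subspace_neg[OF assms] by simp
  then show "infdist y V \<le> infdist x V"
    using infdist_subspace_add[OF assms(1), of "y - x" x] by simp
qed

lemma scaleC_zero_left [simp]: "0 *\<^sub>C x = (0 :: 'a::complex_normed_vector)"
  by (simp flip: norm_eq_zero add: norm_scaleC)

lemma scaleC_minus_left: "(- c) *\<^sub>C x = - (c *\<^sub>C x :: 'a::complex_normed_vector)"
  using scaleC_add_left[of c "- c" x] by (simp add: eq_neg_iff_add_eq_0 add.commute)

lemma scaleC_diff_right: "c *\<^sub>C (x - y) = c *\<^sub>C x - (c *\<^sub>C y :: 'a::complex_normed_vector)"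
  by (rule bounded_linear.linear[OF bounded_linear_scaleC, THEN linear_diff])

lemma scaleC_sum_left: "sum f I *\<^sub>C x = (\<Sum>i\<in>I. f i *\<^sub>C (x :: 'a::complex_normed_vector))"
  by (induction I rule: infinite_finite_induct) (simp_all add: scaleC_add_left)

lemma scaleC_sum_right: "c *\<^sub>C sum f I = (\<Sum>i\<in>I. c *\<^sub>C (f i :: 'a::complex_normed_vector))"
  by (rule bounded_linear.linear[OF bounded_linear_scaleC, THEN linear_sum])

text \<open>Scaling approximants gives one inequality; the same inequality for
  \<open>inverse c\<close> gives the other.\<close>

lemma infdist_csubspace_scaleC:
  fixes V :: "'a::complex_normed_vector set"
  assumes "csubspace V"
  shows "infdist (c *\<^sub>C x) V = cmod c * infdist x V"
proof -
  have le: "infdist (d *\<^sub>C y) V \<le> cmod d * infdist y V" for d and y :: 'a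
  proof (rule field_le_epsilon)
    fix e :: real assume "e > 0"
    define e' where "e' = e / (cmod d + 1)"
    have e': "e' > 0" using \<open>e > 0\<close> by (simp add: e'_def add_nonneg_pos)
    have "V \<noteq> {}" using assms by (auto simp: csubspace_iff)
    then obtain v where v: "v \<in> V" "dist y v < infdist y V + e'"
      using infdist_approx e' by metis
    have "infdist (d *\<^sub>C y) V \<le> dist (d *\<^sub>C y) (d *\<^sub>C v)"
      using assms v by (intro infdist_le) (auto simp: csubspace_iff)
    also have "\<dots> = cmod d * dist y v"
      by (simp add: dist_norm norm_scaleC flip: scaleC_diff_right)
    also have "\<dots> \<le> cmod d * (infdist y V + e')"
      using v by (intro mult_left_mono) auto
    also have "cmod d * e' \<le> e"
      using \<open>e > 0\<close> by (simp add: e'_def field_simps add_pos_nonneg)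
    then have "cmod d * (infdist y V + e') \<le> cmod d * infdist y V + e"
      by (simp add: distrib_left)
    finally show "infdist (d *\<^sub>C y) V \<le> cmod d * infdist y V + e" .
  qed
  show ?thesis
  proof (cases "c = 0")
    case True
    then show ?thesis using assms by (simp add: csubspace_iff)
  next
    case False
    then have "infdist x V \<le> cmod (inverse c) * infdist (c *\<^sub>C x) V"
      using le[of "inverse c" "c *\<^sub>C x"] by (simp add: scaleC_scaleC scaleC_one)
    then have "cmod c * infdist x V \<le> infdist (c *\<^sub>C x) V"
      using False by (simp add: norm_divide field_simps)
    with le[of c x] show ?thesis by simp
  qed
qed

section \<open>Complex-linear operators and their topologies\<close>

lemma csubspace_imp_subspace: "csubspace S \<Longrightarrow> subspace S"
  by (simp add: csubspace_iff subspace_def scaleR_scaleC)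

lemma scaleC_blinfun_apply [simp]: "blinfun_apply (c *\<^sub>C S) x = c *\<^sub>C blinfun_apply S x"
  by (simp add: scaleC_blinfun.rep_eq)

lemma complex_operators_apply: "S \<in> \<B> \<Longrightarrow> blinfun_apply S (c *\<^sub>C x) = c *\<^sub>C blinfun_apply S x"
  by (simp add: complex_operators_def)

lemma blinfun_compose_scaleC_right: "S \<in> \<B> \<Longrightarrow> S o\<^sub>L (c *\<^sub>C T) = c *\<^sub>C (S o\<^sub>L T)"
  by (rule blinfun_eqI) (simp add: complex_operators_apply)

lemmas blinfun_compose_bilinear =
  bounded_bilinear.add_left[OF bounded_bilinear_blinfun_compose]
  bounded_bilinear.add_right[OF bounded_bilinear_blinfun_compose]
  bounded_bilinear.diff_left[OF bounded_bilinear_blinfun_compose]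
  bounded_bilinear.diff_right[OF bounded_bilinear_blinfun_compose]

lemma closed_complex_operators: "closed (\<B> :: ('a::complex_normed_vector \<Rightarrow>\<^sub>L 'a) set)"
proof -
  have "closed {T :: 'a \<Rightarrow>\<^sub>L 'a. blinfun_apply T (c *\<^sub>C x) = c *\<^sub>C blinfun_apply T x}" for c x
    by (intro closed_Collect_eq continuous_intros
        bounded_linear.continuous_on[OF bounded_linear_scaleC])
  then have "closed {T :: 'a \<Rightarrow>\<^sub>L 'a. \<forall>c x. blinfun_apply T (c *\<^sub>C x) = c *\<^sub>C blinfun_apply T x}"
    by (intro closed_Collect_all)
  then show ?thesis by (simp add: complex_operators_def)
qed

text \<open>Strong closedness is relative to \<open>\<B>\<close>. The norm topology is finer than
  the strong one, and \<open>\<B>\<close> is itself norm closed, so the trace on \<open>\<B>\<close>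
  of a strongly closed set is norm closed.\<close>

lemma strongly_closed_imp_closed:
  assumes "strongly_closed S"
  shows "closed S"
proof -
  obtain F where F: "closedin strong_operator_topology F" "S = F \<inter> \<B>"
    using assms by (auto simp: strongly_closed_def closedin_subtopology)
  have "closed F"
    using closedin_continuous_map_preimage[OF strong_operator_topology_weaker_than_euclidean F(1)]
    by simp
  then show ?thesis using F closed_complex_operators by auto
qed

section \<open>Commutative unital Banach algebras of operators\<close>

text \<open>Closedness is meant in the norm: it makes \<open>A\<close> complete, as the inversion
  argument and the open mapping theorem require.\<close>

locale commutative_operator_algebra =
  fixes A :: "('a::complex_banach \<Rightarrow>\<^sub>L 'a) set"
  assumes subalgebra: "operator_subalgebra A" and abelian: "abelian A"
    and unital: "unital A" and closed: "closed A"
begin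

lemma csubspace: "csubspace A"
  using subalgebra by (simp add: operator_subalgebra_def)

lemma subspace: "subspace A"
  by (rule csubspace_imp_subspace[OF csubspace])

lemma in_operators: "S \<in> A \<Longrightarrow> S \<in> \<B>"
  using subalgebra by (auto simp: operator_subalgebra_def)

lemma scaleC_mem: "S \<in> A \<Longrightarrow> c *\<^sub>C S \<in> A"
  using csubspace by (simp add: csubspace_iff)

lemma compose_mem: "S \<in> A \<Longrightarrow> T \<in> A \<Longrightarrow> S o\<^sub>L T \<in> A"
  using subalgebra by (simp add: operator_subalgebra_def)

lemma commute: "S \<in> A \<Longrightarrow> T \<in> A \<Longrightarrow> S o\<^sub>L T = T o\<^sub>L S"
  using abelian by (simp add: abelian_def)

lemma commute_apply: "S \<in> A \<Longrightarrow> T \<in> A \<Longrightarrow> blinfun_apply S (blinfun_apply T x) = blinfun_apply T (blinfun_apply S x)"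
  by (metis commute blinfun_apply_blinfun_compose)

lemma id_mem: "id_blinfun \<in> A"
  using unital by (simp add: unital_def)

lemma algebra_idealI:
  assumes "J \<subseteq> A" "csubspace J" "\<And>S T. S \<in> A \<Longrightarrow> T \<in> J \<Longrightarrow> S o\<^sub>L T \<in> J"
  shows "algebra_ideal A J"
  using assms commute by (fastforce simp: algebra_ideal_def)

end

section \<open>Maximal ideals and the quotient norm\<close>

locale maximal_ideal = commutative_operator_algebra +
  fixes M
  assumes maximal: "maximal_algebra_ideal A M"
begin

lemma subset: "M \<subseteq> A"
  using maximal by (simp add: maximal_algebra_ideal_def algebra_ideal_def)

lemma csubspace_M: "csubspace M"
  using maximal by (simp add: maximal_algebra_ideal_def algebra_ideal_def)

lemma subspace_M: "subspace M"
  by (rule csubspace_imp_subspace[OF csubspace_M])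

lemma scaleC_mem_M: "S \<in> M \<Longrightarrow> c *\<^sub>C S \<in> M"
  using csubspace_M by (simp add: csubspace_iff)

lemma compose_mem_M: "S \<in> A \<Longrightarrow> T \<in> M \<Longrightarrow> S o\<^sub>L T \<in> M" "S \<in> A \<Longrightarrow> T \<in> M \<Longrightarrow> T o\<^sub>L S \<in> M"
  using maximal by (simp_all add: maximal_algebra_ideal_def algebra_ideal_def)

lemma id_notin: "id_blinfun \<notin> M"
proof
  assume "id_blinfun \<in> M"
  then have "S o\<^sub>L id_blinfun \<in> M" if "S \<in> A" for S
    using compose_mem_M that by blast
  moreover have "S o\<^sub>L id_blinfun = S" for S :: "'a \<Rightarrow>\<^sub>L 'a" by (rule blinfun_eqI) simp
  ultimately show False
    using maximal subset by (auto simp: maximal_algebra_ideal_def)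
qed

lemma maximalD: "algebra_ideal A J \<Longrightarrow> M \<subseteq> J \<Longrightarrow> J \<noteq> M \<Longrightarrow> J = A"
  using maximal by (auto simp: maximal_algebra_ideal_def)

text \<open>An element of \<open>A\<close> at distance less than 1 from the identity is invertible in \<open>A\<close>: its inverse
  is a fixed point of a contraction of \<open>A\<close>.\<close>
lemma id_notin_closure: "id_blinfun \<notin> closure M"
proof
  assume "id_blinfun \<in> closure M"
  then obtain m where m: "m \<in> M" "dist m id_blinfun < 1"
    by (meson closure_approachable zero_less_one)
  have mA: "m \<in> A" using m subset by auto
  have "\<exists>!y\<in>A. id_blinfun + (y - (m o\<^sub>L y)) = y"
  proof (rule Banach_fix[where c = "dist m id_blinfun"])
    show "complete A" using closed by (simp add: complete_eq_closed)
    show "A \<noteq> {}" using id_mem by auto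
    show "(\<lambda>y. id_blinfun + (y - (m o\<^sub>L y))) ` A \<subseteq> A"
      by (auto intro!: subspace_add subspace_diff subspace id_mem compose_mem mA)
    fix y z :: "'a \<Rightarrow>\<^sub>L 'a"
    have "dist (id_blinfun + (y - (m o\<^sub>L y))) (id_blinfun + (z - (m o\<^sub>L z)))
      = norm ((id_blinfun - m) o\<^sub>L (y - z))"
      unfolding dist_norm by (rule arg_cong[where f = norm], rule blinfun_eqI)
        (simp add: blinfun.bilinear_simps algebra_simps)
    also have "\<dots> \<le> dist m id_blinfun * dist y z"
      using norm_blinfun_compose[of "id_blinfun - m" "y - z"]
      by (simp add: dist_norm norm_minus_commute)
    finally show "dist (id_blinfun + (y - (m o\<^sub>L y))) (id_blinfun + (z - (m o\<^sub>L z)))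
      \<le> dist m id_blinfun * dist y z" .
  qed (use m in auto)
  then obtain y where y: "y \<in> A" "id_blinfun + (y - (m o\<^sub>L y)) = y" by blast
  then have "id_blinfun = m o\<^sub>L y" by (simp add: algebra_simps)
  then show False using compose_mem_M(2)[OF y(1) m(1)] id_notin by simp
qed

text \<open>The closure of \<open>M\<close> is again an ideal, and it is proper because it omits the
  identity; maximality leaves only \<open>M\<close> itself.\<close>

lemma closed_M: "closed M"
proof -
  have lin: "f T \<in> closure M" if "bounded_linear f" "\<And>T. T \<in> M \<Longrightarrow> f T \<in> M" "T \<in> closure M" for f T
    using closure_bounded_linear_image_subset[OF that(1), of M] closure_mono[of "f ` M" M] that by blast
  have "algebra_ideal A (closure M)"
  proof (rule algebra_idealI)
    show "closure M \<subseteq> A" by (rule closure_minimal[OF subset closed])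
    have "S + T \<in> closure M" if ST: "S \<in> closure M" "T \<in> closure M" for S T
    proof -
      obtain f g where "\<And>n. f n \<in> M" "f \<longlonglongrightarrow> S" "\<And>n. g n \<in> M" "g \<longlonglongrightarrow> T"
        using ST unfolding closure_sequential by blast
      then show ?thesis
        unfolding closure_sequential
        by (intro exI[of _ "\<lambda>n. f n + g n"]) (auto intro!: subspace_add[OF subspace_M] tendsto_add)
    qed
    moreover have "0 \<in> closure M" using subspace_0[OF subspace_M] closure_subset by blast
    ultimately show "csubspace (closure M)"
      by (auto simp: csubspace_iff intro: lin[OF bounded_linear_scaleC scaleC_mem_M])
    show "S o\<^sub>L T \<in> closure M" if "S \<in> A" "T \<in> closure M" for S T
      using lin[OF bounded_bilinear.bounded_linear_right[OF bounded_bilinear_blinfun_compose]]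
        compose_mem_M that by blast
  qed
  then have "closure M = M"
    using maximalD[of "closure M"] closure_subset id_notin_closure id_mem by blast
  then show ?thesis by (metis closed_closure)
qed

text \<open>This is the norm of the class of \<open>T\<close> in \<open>A / M\<close>. The quotient
  is never formed as a type: its computations are done with representatives, as membership of
  differences in \<open>M\<close>.\<close>

definition qnorm :: "('a \<Rightarrow>\<^sub>L 'a) \<Rightarrow> real" where "qnorm T = infdist T M"

lemma qnorm_nonneg: "qnorm T \<ge> 0"
  by (simp add: qnorm_def infdist_nonneg)

lemma qnorm_add: "qnorm (S + T) \<le> qnorm S + qnorm T"
  unfolding qnorm_def by (rule infdist_subspace_add[OF subspace_M])

lemma qnorm_cong: "S - T \<in> M \<Longrightarrow> qnorm S = qnorm T"
  unfolding qnorm_def by (rule infdist_subspace_cong[OF subspace_M])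

lemma qnorm_scaleC: "qnorm (c *\<^sub>C T) = cmod c * qnorm T"
  unfolding qnorm_def by (rule infdist_csubspace_scaleC[OF csubspace_M])

lemma qnorm_eq_0: "qnorm T = 0 \<longleftrightarrow> T \<in> M"
  using in_closed_iff_infdist_zero[OF closed_M, of T] subspace_0[OF subspace_M] by (auto simp: qnorm_def)

lemma qnorm_sum: "qnorm (sum f I) \<le> (\<Sum>i\<in>I. qnorm (f i))"
proof (induction I rule: infinite_finite_induct)
  case (insert i I)
  then show ?case using qnorm_add[of "f i" "sum f I"] by simp
qed (use qnorm_eq_0[of 0] subspace_0[OF subspace_M] in auto)

text \<open>For \<open>m\<close> and \<open>n\<close> in \<open>M\<close> the product of
  \<open>S - m\<close> and \<open>T - n\<close> represents the class of
  \<open>S o\<^sub>L T\<close>. Choosing \<open>m\<close> and \<open>n\<close> nearly optimal and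
  letting the slack \<open>e\<close> tend to 0 gives the bound.\<close>

lemma qnorm_compose:
  assumes "S \<in> A" "T \<in> A"
  shows "qnorm (S o\<^sub>L T) \<le> qnorm S * qnorm T"
proof -
  have ne: "M \<noteq> {}" using subspace_0[OF subspace_M] by auto
  have *: "qnorm (S o\<^sub>L T) \<le> (qnorm S + e) * (qnorm T + e)" if e: "e > 0" for e
  proof -
    obtain m where m: "m \<in> M" "dist S m < qnorm S + e"
      using infdist_approx[OF ne e] unfolding qnorm_def by metis
    obtain n where n: "n \<in> M" "dist T n < qnorm T + e"
      using infdist_approx[OF ne e] unfolding qnorm_def by metis
    have "(S o\<^sub>L n) + (m o\<^sub>L (T - n)) \<in> M"
      using assms m n subset
      by (intro subspace_add[OF subspace_M] compose_mem_M subspace_diff[OF subspace]) auto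
    then have "qnorm (S o\<^sub>L T) \<le> dist (S o\<^sub>L T) ((S o\<^sub>L n) + (m o\<^sub>L (T - n)))"
      unfolding qnorm_def by (rule infdist_le)
    also have "\<dots> = norm ((S - m) o\<^sub>L (T - n))"
      by (simp add: dist_norm blinfun_compose_bilinear algebra_simps)
    also have "\<dots> \<le> norm (S - m) * norm (T - n)" by (rule norm_blinfun_compose)
    also have "\<dots> \<le> (qnorm S + e) * (qnorm T + e)"
      using m n qnorm_nonneg[of S] e by (intro mult_mono) (auto simp: dist_norm)
    finally show ?thesis .
  qed
  have "((\<lambda>e. (qnorm S + e) * (qnorm T + e)) \<longlongrightarrow> (qnorm S + 0) * (qnorm T + 0)) (at_right 0)"
    by (intro tendsto_intros)
  moreover have "eventually (\<lambda>e. qnorm (S o\<^sub>L T) \<le> (qnorm S + e) * (qnorm T + e)) (at_right 0)"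
    using * by (auto simp: eventually_at_right_field intro!: exI[of _ 1])
  ultimately show ?thesis
    by (simp add: tendsto_lowerbound)
qed

text \<open>The ideal generated by \<open>M\<close> and \<open>S\<close> is strictly larger than
  \<open>M\<close>, so it is all of \<open>A\<close> and contains the identity.\<close>

lemma exists_inverse_mod:
  assumes "S \<in> A" "S \<notin> M"
  shows "\<exists>R\<in>A. (S o\<^sub>L R) - id_blinfun \<in> M"
proof -
  define J where "J = {m + (S o\<^sub>L T) | m T. m \<in> M \<and> T \<in> A}"
  have JI: "m + (S o\<^sub>L T) \<in> J" if "m \<in> M" "T \<in> A" for m T
    using that by (auto simp: J_def)
  have "algebra_ideal A J"
  proof (rule algebra_idealI)
    show "J \<subseteq> A"
      using subset assms(1) by (auto simp: J_def intro!: subspace_add[OF subspace] compose_mem)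
    show "csubspace J"
      unfolding csubspace_iff
    proof (intro conjI ballI allI)
      show "0 \<in> J" using JI[OF subspace_0[OF subspace_M] subspace_0[OF subspace]] by simp
      fix x assume "x \<in> J"
      then obtain m T where x: "x = m + (S o\<^sub>L T)" "m \<in> M" "T \<in> A" by (auto simp: J_def)
      show "c *\<^sub>C x \<in> J" for c
        using JI[OF scaleC_mem_M[OF x(2), of c] scaleC_mem[OF x(3), of c]] assms(1)
        by (simp add: x(1) scaleC_add_right blinfun_compose_scaleC_right in_operators)
      fix y assume "y \<in> J"
      then obtain n U where y: "y = n + (S o\<^sub>L U)" "n \<in> M" "U \<in> A" by (auto simp: J_def)
      show "x + y \<in> J"
        using JI[OF subspace_add[OF subspace_M x(2) y(2)] subspace_add[OF subspace x(3) y(3)]]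
        by (simp add: x(1) y(1) blinfun_compose_bilinear algebra_simps)
    qed
    fix U T assume U: "U \<in> A" "T \<in> J"
    then obtain m V where T: "T = m + (S o\<^sub>L V)" "m \<in> M" "V \<in> A" by (auto simp: J_def)
    have "U o\<^sub>L T = (U o\<^sub>L m) + (S o\<^sub>L (U o\<^sub>L V))"
      using U assms(1) by (auto simp: T(1) blinfun.bilinear_simps commute_apply intro!: blinfun_eqI)
    then show "U o\<^sub>L T \<in> J"
      using JI[OF compose_mem_M(1)[OF U(1) T(2)] compose_mem[OF U(1) T(3)]] by simp
  qed
  moreover have "M \<subseteq> J" using JI[OF _ subspace_0[OF subspace]] by auto
  moreover have "J \<noteq> M"
    using JI[OF subspace_0[OF subspace_M] id_mem] assms(2)
    by (metis add_0 blinfun_apply_blinfun_compose blinfun_apply_id_blinfun blinfun_eqI)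
  ultimately have "J = A" by (rule maximalD)
  then have "id_blinfun \<in> J" using id_mem by simp
  then obtain m R where "id_blinfun = m + (S o\<^sub>L R)" "m \<in> M" "R \<in> A"
    unfolding J_def by blast
  moreover from this have "(S o\<^sub>L R) - id_blinfun = - m" by (simp add: algebra_simps)
  ultimately show ?thesis using subspace_neg[OF subspace_M] by metis
qed

section \<open>The Gelfand-Mazur theorem for the quotient by a maximal ideal\<close>

text \<open>The quotient \<open>A / M\<close> is a Banach field. If it were not \<open>\<complex>\<close>, the norm of a resolvent
  would satisfy the hypotheses of \<open>submean_vanishing_eq_0\<close>: the four-point inequality comes from expanding
  the resolvent to order 4, where the terms of order 1 to 3 cancel in the sum over \<open>\<i>\<^sup>k r\<close>.\<close>
theorem gelfand_mazur:
  assumes "b \<in> A"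
  shows "\<exists>c. b - c *\<^sub>C id_blinfun \<in> M"
proof (rule ccontr)
  assume no: "\<nexists>c. b - c *\<^sub>C id_blinfun \<in> M"
  have bA: "b - z *\<^sub>C id_blinfun \<in> A" for z
    by (intro subspace_diff subspace assms scaleC_mem id_mem)
  \<comment> \<open>\<open>R z\<close> is a representative of the resolvent of \<open>b\<close> at
    \<open>z\<close> in the field \<open>A / M\<close>; it exists for every \<open>z\<close> because
    no \<open>b - z *\<^sub>C id_blinfun\<close> lies in \<open>M\<close>.\<close>
  have "\<forall>z. \<exists>R\<in>A. ((b - z *\<^sub>C id_blinfun) o\<^sub>L R) - id_blinfun \<in> M"
    using exists_inverse_mod[OF bA] no by blast
  then obtain R where RA: "\<And>z. R z \<in> A"
    and R: "\<And>z. ((b - z *\<^sub>C id_blinfun) o\<^sub>L R z) - id_blinfun \<in> M"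
    by metis
  note R_scaleC = complex_operators_apply[OF in_operators[OF RA]]
  define \<phi> where "\<phi> z = qnorm (R z)" for z
  have \<phi>_nonneg: "\<phi> z \<ge> 0" for z by (simp add: \<phi>_def qnorm_nonneg)

  \<comment> \<open>This is the resolvent identity modulo \<open>M\<close>: multiply the inverse
    relation at each point by the resolvent at the other and subtract.\<close>
  have resolvent: "R (z + c) - (R z + c *\<^sub>C (R z o\<^sub>L R (z + c))) \<in> M" for z c
  proof -
    have "(R z o\<^sub>L (((b - (z + c) *\<^sub>C id_blinfun) o\<^sub>L R (z + c)) - id_blinfun))
        - (R (z + c) o\<^sub>L (((b - z *\<^sub>C id_blinfun) o\<^sub>L R z) - id_blinfun)) \<in> M"
      by (intro subspace_diff subspace_M compose_mem_M RA R)
    also have "(R z o\<^sub>L (((b - (z + c) *\<^sub>C id_blinfun) o\<^sub>L R (z + c)) - id_blinfun))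
        - (R (z + c) o\<^sub>L (((b - z *\<^sub>C id_blinfun) o\<^sub>L R z) - id_blinfun))
        = R (z + c) - (R z + c *\<^sub>C (R z o\<^sub>L R (z + c)))"
      by (rule blinfun_eqI)
        (simp add: blinfun.bilinear_simps R_scaleC scaleC_add_left scaleC_add_right
          commute_apply[OF RA assms] commute_apply[OF RA[of "z + c"] RA[of z]])
    finally show ?thesis .
  qed

  have lipschitz: "\<bar>\<phi> w - \<phi> z\<bar> \<le> cmod (w - z) * \<phi> z * \<phi> w" for w z
  proof -
    have "\<phi> w \<le> \<phi> z + cmod (w - z) * \<phi> z * \<phi> w" for w z
    proof -
      have "\<phi> w = qnorm (R z + (w - z) *\<^sub>C (R z o\<^sub>L R w))"
        unfolding \<phi>_def using qnorm_cong[OF resolvent[of z "w - z"]] by simp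
      also have "\<dots> \<le> \<phi> z + cmod (w - z) * qnorm (R z o\<^sub>L R w)"
        unfolding \<phi>_def by (rule order_trans[OF qnorm_add]) (simp add: qnorm_scaleC)
      also have "\<dots> \<le> \<phi> z + cmod (w - z) * (\<phi> z * \<phi> w)"
        unfolding \<phi>_def by (intro add_left_mono mult_left_mono qnorm_compose RA) simp
      finally show ?thesis by (simp add: mult.assoc)
    qed
    from this[of w z] this[of z w] show ?thesis
      by (simp add: norm_minus_commute mult_ac abs_le_iff)
  qed
  have cont: "continuous_on UNIV \<phi>"
  proof (rule continuous_at_imp_continuous_on, rule ballI)
    fix z
    \<comment> \<open>For \<open>w\<close> this close to \<open>z\<close> the factor
      \<open>cmod (w - z) * \<phi> z\<close> is at most 1/2, so the right side of
      \<open>lipschitz\<close> absorbs into \<open>\<phi> w \<le> 2 * \<phi> z\<close>. The bound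
      then no longer involves \<open>\<phi> w\<close>.\<close>
    have "eventually (\<lambda>w. norm (\<phi> w - \<phi> z) \<le> cmod (w - z) * \<phi> z * (2 * \<phi> z)) (at z)"
      unfolding eventually_at
    proof (intro exI[of _ "1 / (2 * \<phi> z + 1)"] conjI ballI impI)
      show "1 / (2 * \<phi> z + 1) > 0" using \<phi>_nonneg[of z] by simp
      fix w assume "w \<noteq> z \<and> dist w z < 1 / (2 * \<phi> z + 1)"
      then have "cmod (w - z) * (2 * \<phi> z + 1) \<le> 1"
        using \<phi>_nonneg[of z] by (simp add: dist_norm field_simps)
      then have "cmod (w - z) * \<phi> z \<le> 1 / 2" by (simp add: algebra_simps) (smt (verit) norm_ge_zero)
      then have "cmod (w - z) * \<phi> z * \<phi> w \<le> 1 / 2 * \<phi> w" by (intro mult_right_mono \<phi>_nonneg)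
      then have "\<phi> w \<le> 2 * \<phi> z" using lipschitz[of w z] by linarith
      then have "cmod (w - z) * \<phi> z * \<phi> w \<le> cmod (w - z) * \<phi> z * (2 * \<phi> z)"
        using \<phi>_nonneg[of z] by (intro mult_left_mono) auto
      then show "norm (\<phi> w - \<phi> z) \<le> cmod (w - z) * \<phi> z * (2 * \<phi> z)"
        using lipschitz[of w z] by simp
    qed
    moreover have "((\<lambda>w. cmod (w - z) * \<phi> z * (2 * \<phi> z)) \<longlongrightarrow> 0) (at z)"
      by (intro tendsto_mult_left_zero tendsto_norm_zero LIM_zero tendsto_ident_at)
    ultimately have "((\<lambda>w. \<phi> w - \<phi> z) \<longlongrightarrow> 0) (at z)"
      by (rule Lim_null_comparison)
    then show "isCont \<phi> z" by (simp add: isCont_def LIM_zero_iff)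
  qed

  \<comment> \<open>Modulo \<open>M\<close>, \<open>z *\<^sub>C R z\<close> equals
    \<open>(b o\<^sub>L R z) - id_blinfun\<close>. Once \<open>cmod z\<close> exceeds
    \<open>2 * qnorm b\<close>, the term with \<open>qnorm b\<close> is absorbed and
    \<open>\<phi>\<close> decays like \<open>1 / cmod z\<close>.\<close>
  have growth: "cmod z * \<phi> z \<le> qnorm b * \<phi> z + qnorm id_blinfun" for z
  proof -
    have "cmod z * \<phi> z = qnorm (z *\<^sub>C R z)" by (simp add: \<phi>_def qnorm_scaleC)
    also have "\<dots> = qnorm ((b o\<^sub>L R z) - id_blinfun)"
    proof (rule qnorm_cong)
      have "(b o\<^sub>L R z) - id_blinfun - z *\<^sub>C R z = ((b - z *\<^sub>C id_blinfun) o\<^sub>L R z) - id_blinfun"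
        by (rule blinfun_eqI) (simp add: blinfun.bilinear_simps)
      with R[of z] have "(b o\<^sub>L R z) - id_blinfun - z *\<^sub>C R z \<in> M" by (simp only:)
      from subspace_neg[OF subspace_M this]
      show "z *\<^sub>C R z - ((b o\<^sub>L R z) - id_blinfun) \<in> M" by (simp add: algebra_simps)
    qed
    also have "\<dots> \<le> qnorm (b o\<^sub>L R z) + qnorm ((-1) *\<^sub>C id_blinfun)"
      using qnorm_add[of "b o\<^sub>L R z" "(-1) *\<^sub>C id_blinfun"] by (simp add: scaleC_minus_left scaleC_one)
    also have "\<dots> \<le> qnorm b * \<phi> z + qnorm id_blinfun"
      using qnorm_compose[OF assms RA, of z] by (simp add: \<phi>_def qnorm_scaleC)
    finally show ?thesis .
  qed
  have lim: "(\<phi> \<longlongrightarrow> 0) at_infinity"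
  proof (rule Lim_null_comparison)
    show "eventually (\<lambda>z. norm (\<phi> z) \<le> (2 * qnorm id_blinfun) * inverse (norm z)) at_infinity"
      unfolding eventually_at_infinity
    proof (intro exI[of _ "2 * qnorm b + 1"] allI impI)
      fix z :: complex assume z: "2 * qnorm b + 1 \<le> norm z"
      then have "cmod z > 0" using qnorm_nonneg[of b] by linarith
      have "qnorm b * \<phi> z \<le> cmod z / 2 * \<phi> z" using z by (intro mult_right_mono \<phi>_nonneg) simp
      then have "cmod z * \<phi> z \<le> 2 * qnorm id_blinfun" using growth[of z] by simp
      then show "norm (\<phi> z) \<le> (2 * qnorm id_blinfun) * inverse (norm z)"
        using \<open>cmod z > 0\<close> \<phi>_nonneg[of z] by (simp add: field_simps)
    qed
    show "((\<lambda>z::complex. (2 * qnorm id_blinfun) * inverse (norm z)) \<longlongrightarrow> 0) at_infinity"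
      by (intro tendsto_mult_right_zero tendsto_inverse_0_at_top filterlim_norm_at_top)
  qed

  have submean: "4 * \<phi> z \<le> (1 + r ^ 4 * \<phi> z ^ 4) * (\<Sum>k<4. \<phi> (z + \<i> ^ k * of_real r))"
    if "r > 0" for z r
  proof -
    define c where "c k = \<i> ^ k * of_real r" for k :: nat
    define V where "V k = R (z + c k)" for k
    define R2 where "R2 = R z o\<^sub>L R z"
    define R3 where "R3 = R z o\<^sub>L R2"
    define R4 where "R4 = R z o\<^sub>L R3"
    have RnA: "R2 \<in> A" "R3 \<in> A" "R4 \<in> A" "V k \<in> A" for k
      by (simp_all add: R2_def R3_def R4_def V_def RA compose_mem)
    \<comment> \<open>The resolvent identity says that \<open>E\<close> vanishes modulo
      \<open>M\<close>. Multiplying \<open>E\<close> by the powers of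
      \<open>c k *\<^sub>C R z\<close> up to the third and adding telescopes to the expansion with
      remainder.\<close>
    have taylor: "V k - (R z + c k *\<^sub>C R2 + (c k)\<^sup>2 *\<^sub>C R3 + (c k) ^ 3 *\<^sub>C R4 + (c k) ^ 4 *\<^sub>C (R4 o\<^sub>L V k)) \<in> M"
      for k
    proof -
      define E where "E = V k - (R z + c k *\<^sub>C (R z o\<^sub>L V k))"
      have "E \<in> M" unfolding E_def V_def by (rule resolvent)
      then have "E + c k *\<^sub>C (R z o\<^sub>L E) + (c k)\<^sup>2 *\<^sub>C (R2 o\<^sub>L E) + (c k) ^ 3 *\<^sub>C (R3 o\<^sub>L E) \<in> M"
        by (intro subspace_add[OF subspace_M] scaleC_mem_M compose_mem_M RA RnA)
      also have "E + c k *\<^sub>C (R z o\<^sub>L E) + (c k)\<^sup>2 *\<^sub>C (R2 o\<^sub>L E) + (c k) ^ 3 *\<^sub>C (R3 o\<^sub>L E)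
          = V k - (R z + c k *\<^sub>C R2 + (c k)\<^sup>2 *\<^sub>C R3 + (c k) ^ 3 *\<^sub>C R4 + (c k) ^ 4 *\<^sub>C (R4 o\<^sub>L V k))"
        by (rule blinfun_eqI)
          (simp add: E_def R2_def R3_def R4_def blinfun.bilinear_simps R_scaleC scaleC_add_right
            scaleC_diff_right scaleC_scaleC power2_eq_square power3_eq_cube power4_eq_xxxx mult.assoc)
      finally show ?thesis .
    qed
    define U where "U = (\<Sum>k<4. V k)"
    have UA: "U \<in> A" unfolding U_def by (intro subspace_sum subspace RnA)
    \<comment> \<open>The \<open>c k\<close> are \<open>r\<close> times the fourth roots of unity,
      so their power sums of exponents 1 to 3 vanish, while each fourth power is
      \<open>r ^ 4\<close>.\<close>
    have c_sums: "(\<Sum>k<4. c k) = 0" "(\<Sum>k<4. (c k)\<^sup>2) = 0" "(\<Sum>k<4. (c k) ^ 3) = 0"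
      by (simp_all add: c_def eval_nat_numeral)
    have c4: "(c k) ^ 4 = of_real (r ^ 4)" for k
      by (simp add: c_def power_mult_distrib flip: power_mult)
    have "(\<Sum>k<4. V k - (R z + c k *\<^sub>C R2 + (c k)\<^sup>2 *\<^sub>C R3 + (c k) ^ 3 *\<^sub>C R4 + (c k) ^ 4 *\<^sub>C (R4 o\<^sub>L V k)))
        = U - (4 *\<^sub>C R z + of_real (r ^ 4) *\<^sub>C (R4 o\<^sub>L U))"
    proof -
      have "(\<Sum>k<4. R4 o\<^sub>L V k) = R4 o\<^sub>L U"
        unfolding U_def by (simp add: bounded_bilinear.sum_right[OF bounded_bilinear_blinfun_compose])
      moreover have "(\<Sum>k<4::nat. R z) = 4 *\<^sub>C R z"
        using scaleR_scaleC[of 4 "R z"] by (simp add: sum_constant_scaleR)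
      ultimately show ?thesis
        by (simp add: sum_subtractf sum.distrib U_def c_sums c4 flip: scaleC_sum_left scaleC_sum_right)
    qed
    moreover have "(\<Sum>k<4. V k - (R z + c k *\<^sub>C R2 + (c k)\<^sup>2 *\<^sub>C R3 + (c k) ^ 3 *\<^sub>C R4 + (c k) ^ 4 *\<^sub>C (R4 o\<^sub>L V k))) \<in> M"
      by (intro subspace_sum subspace_M taylor)
    ultimately have "U - (4 *\<^sub>C R z + of_real (r ^ 4) *\<^sub>C (R4 o\<^sub>L U)) \<in> M" by simp
    then have "(U - of_real (r ^ 4) *\<^sub>C (R4 o\<^sub>L U)) - 4 *\<^sub>C R z \<in> M" by (simp add: algebra_simps)
    have "4 * \<phi> z = qnorm (4 *\<^sub>C R z)" by (simp add: \<phi>_def qnorm_scaleC)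
    also have "\<dots> = qnorm (U + (- of_real (r ^ 4)) *\<^sub>C (R4 o\<^sub>L U))"
      using qnorm_cong[OF \<open>(U - of_real (r ^ 4) *\<^sub>C (R4 o\<^sub>L U)) - 4 *\<^sub>C R z \<in> M\<close>]
      by (simp add: scaleC_minus_left)
    also have "\<dots> \<le> qnorm U + r ^ 4 * qnorm (R4 o\<^sub>L U)"
      by (rule order_trans[OF qnorm_add])
        (use qnorm_scaleC[of "- of_real (r ^ 4)"] that in \<open>simp add: norm_power\<close>)
    also have "\<dots> \<le> qnorm U + r ^ 4 * (\<phi> z ^ 4 * qnorm U)"
    proof (intro add_left_mono mult_left_mono)
      have step: "qnorm (R z o\<^sub>L T) \<le> \<phi> z * t" if "T \<in> A" "qnorm T \<le> t" for T t
        using qnorm_compose[OF RA[of z] that(1)] mult_left_mono[OF that(2) \<phi>_nonneg[of z]] by (simp add: \<phi>_def)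
      have "qnorm R4 \<le> \<phi> z * (\<phi> z * (\<phi> z * \<phi> z))"
        unfolding R4_def R3_def R2_def by (intro step compose_mem RA) (simp add: \<phi>_def)
      then have "qnorm R4 \<le> \<phi> z ^ 4" by (simp add: power4_eq_xxxx mult.assoc)
      then show "qnorm (R4 o\<^sub>L U) \<le> \<phi> z ^ 4 * qnorm U"
        using qnorm_compose[OF RnA(3) UA] mult_right_mono[OF _ qnorm_nonneg[of U]] order_trans by blast
    qed simp
    also have "\<dots> = (1 + r ^ 4 * \<phi> z ^ 4) * qnorm U" by (simp add: algebra_simps)
    also have "\<dots> \<le> (1 + r ^ 4 * \<phi> z ^ 4) * (\<Sum>k<4. \<phi> (z + c k))"
      using qnorm_sum[of V "{..<4}"] by (intro mult_left_mono) (auto simp: \<phi>_def U_def V_def)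
    finally show ?thesis by (simp add: c_def)
  qed
  have "\<phi> 0 = 0"
    using submean
    by (intro submean_vanishing_eq_0[OF \<phi>_nonneg cont lim]) (simp add: eval_nat_numeral add_ac)
  then have "R 0 \<in> M" by (simp add: \<phi>_def qnorm_eq_0)
  \<comment> \<open>Zero cannot have an inverse modulo the proper ideal \<open>M\<close>: the
    identity would lie in \<open>M\<close>.\<close>
  then have "(b - 0 *\<^sub>C id_blinfun) o\<^sub>L R 0 \<in> M" using bA compose_mem_M by blast
  from subspace_diff[OF subspace_M this R[of 0]] show False using id_notin by simp
qed

end

section \<open>Commutation on a closed cyclic subspace\<close>

text \<open>With \<open>T x = t x\<close> and \<open>T (b x) = c x\<close> for some
  \<open>t\<close>, \<open>c\<close> in \<open>A\<close>, the claim says that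
  \<open>c - (t o\<^sub>L b)\<close> annihilates \<open>x\<close>. Synthesis tests this in each
  maximal ideal over the annihilator, where \<open>b\<close> is a scalar. The constant
  \<open>C\<close> turns small vectors of the orbit into operators of small norm.\<close>

lemma (in commutative_operator_algebra) intertwines_on_orbit:
  assumes synthesis: "spectral_synthesis A"
    and T: "T \<in> \<B>" "\<And>y. blinfun_apply T y \<in> closure (orbit A y)"
    and orbit: "closed (orbit A x)" "C \<ge> 0"
      "\<And>y. y \<in> orbit A x \<Longrightarrow> \<exists>a\<in>A. blinfun_apply a x = y \<and> norm a \<le> C * norm y"
    and b: "b \<in> A"
  shows "blinfun_apply T (blinfun_apply b x) = blinfun_apply b (blinfun_apply T x)"
proof -
  have "blinfun_apply T x \<in> orbit A x" using T(2)[of x] orbit(1) by simp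
  then obtain t where t: "t \<in> A" "blinfun_apply T x = blinfun_apply t x" by (auto simp: orbit_def)
  have "orbit A (blinfun_apply b x) \<subseteq> orbit A x"
  proof
    fix y assume "y \<in> orbit A (blinfun_apply b x)"
    then obtain a where "a \<in> A" "y = blinfun_apply (a o\<^sub>L b) x" by (auto simp: orbit_def)
    then show "y \<in> orbit A x" using compose_mem[OF _ b] unfolding orbit_def by blast
  qed
  then have "blinfun_apply T (blinfun_apply b x) \<in> orbit A x"
    using T(2)[of "blinfun_apply b x"] closure_minimal[OF _ orbit(1)] by blast
  then obtain c where c: "c \<in> A" "blinfun_apply T (blinfun_apply b x) = blinfun_apply c x"
    by (auto simp: orbit_def)
  define J where "J = {a \<in> A. blinfun_apply a x = 0}"
  have "algebra_ideal A J"
  proof (rule algebra_idealI)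
    show "csubspace J"
      using subspace_add[OF subspace] scaleC_mem subspace_0[OF subspace]
      by (auto simp: J_def csubspace_iff blinfun.bilinear_simps
          linear_0[OF bounded_linear.linear[OF bounded_linear_scaleC]])
  qed (auto simp: J_def compose_mem)
  moreover have "closedin (top_of_set A) J"
  proof (rule closed_subset)
    have "closed {a :: 'a \<Rightarrow>\<^sub>L 'a. blinfun_apply a x = 0}"
      by (intro closed_Collect_eq continuous_intros)
    moreover have "J = A \<inter> {a. blinfun_apply a x = 0}" by (auto simp: J_def)
    ultimately show "closed J" by (simp only:) (intro closed_Int closed)
  qed (auto simp: J_def)
  ultimately have J: "J = A \<inter> \<Inter>{M. maximal_algebra_ideal A M \<and> J \<subseteq> M}"
    using synthesis unfolding spectral_synthesis_def by blast
  have "c - (t o\<^sub>L b) \<in> M" if M: "maximal_algebra_ideal A M" "J \<subseteq> M" for M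
  proof -
    interpret maximal_ideal A M by unfold_locales (rule M(1))
    obtain l where l: "b - l *\<^sub>C id_blinfun \<in> M" using gelfand_mazur[OF b] by blast
    define m where "m = b - l *\<^sub>C id_blinfun"
    have m: "m \<in> M" "m \<in> A" using l subset by (auto simp: m_def)
    define d where "d = c - l *\<^sub>C t"
    have d: "d \<in> A" unfolding d_def by (intro subspace_diff subspace scaleC_mem c t)
    have Tm: "blinfun_apply T (blinfun_apply m x) = blinfun_apply d x"
      by (simp add: m_def d_def blinfun.bilinear_simps complex_operators_apply[OF T(1)] c t)
    \<comment> \<open>\<open>d x = T (m x)\<close> is within \<open>e\<close> of some
      \<open>s m x\<close>. The difference lifts to an \<open>a\<close> of norm at most
      \<open>C * e\<close>, and \<open>d\<close> equals \<open>a\<close> modulo \<open>M\<close>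
      because \<open>M\<close> contains both \<open>J\<close> and \<open>s o\<^sub>L m\<close>. Thus
      \<open>d\<close> has arbitrarily small quotient norm.\<close>
    have le: "qnorm d \<le> C * e" if "e > 0" for e
    proof -
      obtain s where s: "s \<in> A" "dist (blinfun_apply s (blinfun_apply m x)) (blinfun_apply d x) < e"
        using T(2)[of "blinfun_apply m x"] \<open>e > 0\<close> unfolding Tm closure_approachable orbit_def by blast
      define y where "y = blinfun_apply (d - (s o\<^sub>L m)) x"
      have "d - (s o\<^sub>L m) \<in> A" by (intro subspace_diff subspace compose_mem d s m)
      then have "y \<in> orbit A x" by (auto simp: y_def orbit_def)
      then obtain a where a: "a \<in> A" "blinfun_apply a x = y" "norm a \<le> C * norm y"
        using orbit(3) by blast
      have "(d - (s o\<^sub>L m)) - a \<in> J"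
        using a \<open>d - (s o\<^sub>L m) \<in> A\<close> by (simp add: J_def y_def blinfun.bilinear_simps subspace_diff[OF subspace])
      then have "((d - (s o\<^sub>L m)) - a) + (s o\<^sub>L m) \<in> M"
        using M(2) by (intro subspace_add[OF subspace_M] compose_mem_M m s) auto
      then have "d - a \<in> M" by simp
      then have "qnorm d = qnorm a" by (rule qnorm_cong)
      also have "qnorm a \<le> norm a"
        using infdist_le[OF subspace_0[OF subspace_M], of a] by (simp add: qnorm_def)
      also have "\<dots> \<le> C * norm y" by (rule a(3))
      also have "\<dots> \<le> C * e"
        using s(2) orbit(2) by (intro mult_left_mono) (simp_all add: y_def dist_norm norm_minus_commute blinfun.bilinear_simps)
      finally show ?thesis .
    qed
    have "qnorm d \<le> 0"
    proof (rule field_le_epsilon)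
      fix e :: real assume "e > 0"
      then have "e / (C + 1) > 0" using orbit(2) by simp
      from le[OF this] have "qnorm d \<le> C * (e / (C + 1))" .
      also have "\<dots> \<le> e" using orbit(2) \<open>e > 0\<close> by (simp add: field_simps)
      finally show "qnorm d \<le> 0 + e" by simp
    qed
    then have "d \<in> M" using qnorm_nonneg[of d] qnorm_eq_0 by simp
    then have "d - (t o\<^sub>L m) \<in> M" by (intro subspace_diff subspace_M compose_mem_M t m)
    moreover have "d - (t o\<^sub>L m) = c - (t o\<^sub>L b)"
      by (rule blinfun_eqI)
        (simp add: d_def m_def blinfun.bilinear_simps complex_operators_apply[OF in_operators[OF t(1)]])
    ultimately show ?thesis by simp
  qed
  moreover have "c - (t o\<^sub>L b) \<in> A" by (intro subspace_diff subspace compose_mem b c t)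
  ultimately have "c - (t o\<^sub>L b) \<in> J" by (subst J) auto
  then have "blinfun_apply c x = blinfun_apply t (blinfun_apply b x)"
    by (simp add: J_def blinfun.bilinear_simps)
  then show ?thesis using c(2) t(2) commute_apply[OF t(1) b, of x] by simp
qed

section \<open>Hereditary reflexivity from the direct sum decomposition\<close>

theorem corollary10:
  fixes A :: "('a::complex_banach \<Rightarrow>\<^sub>L 'a) set" and p :: nat
  assumes "operator_subalgebra A"
    and "abelian A"
    and "unital A"
    and "strongly_closed A"
    and "spectral_synthesis A"
    and "split_strict_multiplicity A p"
  shows "hereditarily_reflexive A"
proof -
  interpret commutative_operator_algebra A
    using assms strongly_closed_imp_closed by unfold_locales
  obtain x where x: "\<And>i. i \<in> {1..p} \<Longrightarrow> closed (orbit A (x i))"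
    and sum: "is_direct_sum (\<lambda>i. orbit A (x i)) {1..p}"
    using assms(6) unfolding split_strict_multiplicity_def by blast
  define I where "I = {1..p}"
  have fin: "finite I" by (simp add: I_def)
  have uniq: "blinfun_apply (a i) (x i) = blinfun_apply (b i) (x i)"
    if a: "\<forall>i\<in>I. a i \<in> A" and b: "\<forall>i\<in>I. b i \<in> A" and i: "i \<in> I"
      and eq: "(\<Sum>i\<in>I. blinfun_apply (a i) (x i)) = (\<Sum>i\<in>I. blinfun_apply (b i) (x i))"
    for a b i
  proof -
    \<comment> \<open>Uniqueness in \<open>is_direct_sum\<close> concerns extensional functions,
      hence the restriction to \<open>I\<close>. It determines the vectors \<open>a i (x i)\<close>,
      not the operators \<open>a i\<close>.\<close>
    define h where "h c = restrict (\<lambda>i. blinfun_apply (c i) (x i)) I" for c :: "nat \<Rightarrow> 'a \<Rightarrow>\<^sub>L 'a"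
    have h: "h c \<in> (\<Pi>\<^sub>E i\<in>I. orbit A (x i))" if "\<forall>i\<in>I. c i \<in> A" for c
      using that by (auto simp: h_def orbit_def)
    have "(\<Sum>i\<in>I. h a i) = (\<Sum>i\<in>I. h b i)" using eq by (simp add: h_def)
    then have "h a = h b"
      using sum h[OF a] h[OF b] unfolding is_direct_sum_def I_def[symmetric] by metis
    from fun_cong[OF this, of i] show ?thesis using i by (simp add: h_def)
  qed
  have "\<exists>a. (\<forall>i\<in>I. a i \<in> A) \<and> y = (\<Sum>i\<in>I. blinfun_apply (a i) (x i))" for y
  proof -
    obtain h where h: "h \<in> (\<Pi>\<^sub>E i\<in>I. orbit A (x i))" "y = (\<Sum>i\<in>I. h i)"
      using sum unfolding is_direct_sum_def I_def[symmetric] by metis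
    then have "\<forall>i\<in>I. \<exists>a\<in>A. h i = blinfun_apply a (x i)" by (fastforce simp: orbit_def)
    then obtain a where "\<forall>i\<in>I. a i \<in> A \<and> h i = blinfun_apply (a i) (x i)" by metis
    then show ?thesis using h(2) by (intro exI[of _ a]) auto
  qed
  then obtain C where C: "C \<ge> 0" and coeff: "\<And>y. \<exists>a. (\<forall>i\<in>I. a i \<in> A \<and> norm (a i) \<le> C * norm y) \<and>
      y = (\<Sum>i\<in>I. blinfun_apply (a i) (x i))"
    using open_mapping_family[OF fin _ subspace closed, of "\<lambda>i a. blinfun_apply a (x i)"]
      blinfun.bounded_linear_left by blast
  \<comment> \<open>This bounds the projections onto the summands: a summand of a vector is
    represented by an operator whose norm is controlled by the whole vector. It combines
    \<open>coeff\<close> with uniqueness of the decomposition.\<close>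
  have component: "\<exists>c\<in>A. blinfun_apply c (x i) = blinfun_apply (a i) (x i) \<and>
      norm c \<le> C * norm (\<Sum>j\<in>I. blinfun_apply (a j) (x j))"
    if a: "\<forall>i\<in>I. a i \<in> A" and i: "i \<in> I" for a i
  proof -
    obtain c where c: "\<forall>i\<in>I. c i \<in> A \<and> norm (c i) \<le> C * norm (\<Sum>j\<in>I. blinfun_apply (a j) (x j))"
        "(\<Sum>j\<in>I. blinfun_apply (a j) (x j)) = (\<Sum>i\<in>I. blinfun_apply (c i) (x i))"
      using coeff by blast
    then have "blinfun_apply (a i) (x i) = blinfun_apply (c i) (x i)"
      using uniq[OF a _ i c(2)] by blast
    then show ?thesis using c(1) i by auto
  qed
  have orbit_bound: "\<exists>a\<in>A. blinfun_apply a (x i) = y \<and> norm a \<le> C * norm y"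
    if y: "y \<in> orbit A (x i)" and i: "i \<in> I" for i y
  proof -
    obtain b where b: "b \<in> A" "y = blinfun_apply b (x i)" using y by (auto simp: orbit_def)
    \<comment> \<open>A vector of the \<open>i\<close>-th summand is its own decomposition, with
      coefficient 0 at every other index.\<close>
    have "(\<Sum>j\<in>I. blinfun_apply ((\<lambda>j. if j = i then b else 0) j) (x j)) = (\<Sum>j\<in>I. if j = i then y else 0)"
      by (intro sum.cong) (auto simp: b)
    also have "\<dots> = y" using i fin by simp
    finally show ?thesis
      using component[of "\<lambda>j. if j = i then b else 0" i] b i subspace_0[OF subspace] by auto
  qed
  show ?thesis
    unfolding hereditarily_reflexive_def reflexive_def
  proof (intro allI impI ballI)
    fix L T
    assume L: "L \<subseteq> A \<and> csubspace L \<and> strongly_closed L" and TB: "T \<in> \<B>"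
      and T: "\<forall>x. blinfun_apply T x \<in> closure (orbit L x)"
    have "closure (orbit L y) \<subseteq> closure (orbit A y)" for y
      using L by (intro closure_mono) (auto simp: orbit_def)
    then have TA: "blinfun_apply T y \<in> closure (orbit A y)" for y using T by blast
    have commutes: "blinfun_apply T (blinfun_apply b (x i)) = blinfun_apply b (blinfun_apply T (x i))"
      if "i \<in> I" "b \<in> A" for i b
      using intertwines_on_orbit[OF assms(5) TB TA x C orbit_bound] that by (auto simp: I_def)
    have "\<forall>i\<in>I. \<exists>t\<in>A. blinfun_apply T (x i) = blinfun_apply t (x i)"
    proof
      fix i assume "i \<in> I"
      then have "blinfun_apply T (x i) \<in> orbit A (x i)" using TA[of "x i"] x[of i] by (simp add: I_def)
      then show "\<exists>t\<in>A. blinfun_apply T (x i) = blinfun_apply t (x i)" by (auto simp: orbit_def)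
    qed
    then obtain t where t: "\<forall>i\<in>I. t i \<in> A \<and> blinfun_apply T (x i) = blinfun_apply (t i) (x i)"
      by metis
    \<comment> \<open>Approximating \<open>T\<close> at the single vector \<open>v\<close> yields
      one \<open>l\<close> that serves all summands at once.\<close>
    define v where "v = (\<Sum>i\<in>I. x i)"
    \<comment> \<open>In each term the outer \<open>C\<close> bounds the coefficient of a vector
      \<open>y\<close>, and \<open>C * norm (x i)\<close> bounds the projection of the error at
      \<open>v\<close> to the \<open>i\<close>-th summand.\<close>
    define K where "K = (\<Sum>i\<in>I. C * (C * norm (x i)))"
    have "K \<ge> 0" unfolding K_def using C by (intro sum_nonneg) auto
    have approx: "\<exists>l\<in>L. dist l T \<le> K * e" if "e > 0" for e
    proof -
      obtain l where l: "l \<in> L" "dist (blinfun_apply l v) (blinfun_apply T v) < e"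
        using T \<open>e > 0\<close> unfolding closure_approachable orbit_def by blast
      have lA: "l \<in> A" using l L by auto
      have "(\<Sum>i\<in>I. blinfun_apply (l - t i) (x i)) = blinfun_apply l v - blinfun_apply T v"
        using t by (simp add: v_def blinfun.bilinear_simps blinfun.sum_right sum_subtractf)
      then have small: "norm (\<Sum>i\<in>I. blinfun_apply (l - t i) (x i)) \<le> e"
        using l(2) by (simp add: dist_norm)
      have lT: "norm (blinfun_apply (l - t i) (x i)) \<le> C * norm (x i) * e" if i: "i \<in> I" for i
      proof -
        have "\<forall>i\<in>I. l - t i \<in> A" using t lA by (auto intro: subspace_diff subspace)
        from component[OF this i] obtain c where c: "blinfun_apply c (x i) = blinfun_apply (l - t i) (x i)"
            "norm c \<le> C * norm (\<Sum>j\<in>I. blinfun_apply (l - t j) (x j))"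
          by blast
        have "norm (blinfun_apply c (x i)) \<le> norm c * norm (x i)" by (rule norm_blinfun)
        also have "\<dots> \<le> C * e * norm (x i)"
          using c(2) mult_left_mono[OF small C] by (intro mult_right_mono) auto
        finally show ?thesis using c(1) by (simp add: mult_ac)
      qed
      have "norm (l - T) \<le> K * e"
      proof (rule norm_blinfun_bound)
        show "0 \<le> K * e" using \<open>K \<ge> 0\<close> \<open>e > 0\<close> by simp
        fix y
        obtain a where a: "\<forall>i\<in>I. a i \<in> A \<and> norm (a i) \<le> C * norm y"
            "y = (\<Sum>i\<in>I. blinfun_apply (a i) (x i))"
          using coeff by blast
        have "blinfun_apply (l - T) y = (\<Sum>i\<in>I. blinfun_apply (l - T) (blinfun_apply (a i) (x i)))"
          by (subst a(2)) (simp add: blinfun.sum_right)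
        \<comment> \<open>\<open>a i\<close> moves past \<open>l\<close> since \<open>A\<close> is
          abelian and past \<open>T\<close> by \<open>commutes\<close>; at \<open>x i\<close> the
          operator \<open>T\<close> then acts as \<open>t i\<close>.\<close>
        also have "\<dots> = (\<Sum>i\<in>I. blinfun_apply (a i) (blinfun_apply (l - t i) (x i)))"
          using a(1) t commutes lA
          by (intro sum.cong) (auto simp: blinfun.bilinear_simps commute_apply[OF lA])
        also have "norm \<dots> \<le> (\<Sum>i\<in>I. C * norm y * (C * norm (x i) * e))"
        proof (rule sum_norm_le)
          fix i assume i: "i \<in> I"
          show "norm (blinfun_apply (a i) (blinfun_apply (l - t i) (x i))) \<le> C * norm y * (C * norm (x i) * e)"
            using a(1) i C by (intro order_trans[OF norm_blinfun] mult_mono lT) auto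
        qed
        also have "\<dots> = K * e * norm y"
          by (simp add: K_def sum_distrib_left sum_distrib_right mult_ac)
        finally show "norm (blinfun_apply (l - T) y) \<le> K * e * norm y" .
      qed
      then show ?thesis using l(1) by (auto simp: dist_norm)
    qed
    have "T \<in> closure L"
      unfolding closure_approachable
    proof (intro allI impI)
      fix e :: real assume "e > 0"
      define e' where "e' = e / (K + 1)"
      have "e' > 0" using \<open>K \<ge> 0\<close> \<open>e > 0\<close> by (simp add: e'_def)
      have "K * e' < e" using \<open>K \<ge> 0\<close> \<open>e > 0\<close> by (simp add: e'_def field_simps)
      with approx[OF \<open>e' > 0\<close>] show "\<exists>l\<in>L. dist l T < e" by force
    qed
    moreover have "closed L" using L strongly_closed_imp_closed by blast
    ultimately show "T \<in> L" by simp
  qed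
qed

end
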